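(* Let $\varphi$ be an increasing concave function on $[0,1]$ such that $0<p_\varphi^0\le q_\varphi^0<1$. Then $C\Lambda_\varphi[0,1]=L_1(w)$ (equal as sets with equivalent norms), where $w(t)=\int_0^{1-t}\frac{\varphi'(s)}{t+s}\,ds$.
   Context: Convention: $\varphi(0)=0$, $\varphi>0$ on $(0,1]$. Lorentz space $\Lambda_\varphi$ on $[0,1]$: measurable $f$ with $\|f\|=\int_0^1f^*(s)\,d\varphi(s)<\infty$, $f^*$ the decreasing rearrangement. With $Cf(x)=\frac1x\int_0^xf(t)\,dt$, $C\Lambda_\varphi[0,1]=\{f:C|f|\in\Lambda_\varphi\}$, $\|f\|=\|C|f|\|_{\Lambda_\varphi}$. $L_1(w)$ has norm $\int_0^1|f(t)|w(t)\,dt$. Indices: $\overline\varphi^0(s)=\sup_{0<t\le\min(1,1/s)}\varphi(st)/\varphi(t)$, $p_\varphi^0=\lim_{s\to0^+}\ln\overline\varphi^0(s)/\ln s$, $q_\varphi^0=\lim_{s\to\infty}\ln\overline\varphi^0(s)/\ln s$. *)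

theory Defs
  imports "HOL-Analysis.Analysis"
begin

definition decr_rearr :: "(real \<Rightarrow> ennreal) \<Rightarrow> real \<Rightarrow> ennreal" where
  "decr_rearr g s =
     Inf {y::ennreal. emeasure lebesgue {x\<in>{0..1}. y < g x} \<le> ennreal s}"

definition cesaro_abs :: "(real \<Rightarrow> real) \<Rightarrow> real \<Rightarrow> ennreal" where
  "cesaro_abs f x = (\<integral>\<^sup>+ t\<in>{0..x}. ennreal \<bar>f t\<bar> \<partial>lebesgue) / ennreal x"

definition stieltjes_phi :: "(real \<Rightarrow> real) \<Rightarrow> real measure" where
  "stieltjes_phi \<phi> = interval_measure (\<lambda>t. \<phi> (max 0 (min 1 t)))"

definition lorentz_norm :: "(real \<Rightarrow> real) \<Rightarrow> (real \<Rightarrow> ennreal) \<Rightarrow> ennreal" where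
  "lorentz_norm \<phi> g = (\<integral>\<^sup>+ s\<in>{0..1}. decr_rearr g s \<partial>stieltjes_phi \<phi>)"

definition weight :: "(real \<Rightarrow> real) \<Rightarrow> real \<Rightarrow> ennreal" where
  "weight \<phi> t = (\<integral>\<^sup>+ s\<in>{0..1-t}. ennreal (deriv \<phi> s / (t + s)) \<partial>lebesgue)"

definition L1w_norm :: "(real \<Rightarrow> ennreal) \<Rightarrow> (real \<Rightarrow> real) \<Rightarrow> ennreal" where
  "L1w_norm w f = (\<integral>\<^sup>+ t\<in>{0..1}. ennreal \<bar>f t\<bar> * w t \<partial>lebesgue)"

definition dil_fun :: "(real \<Rightarrow> real) \<Rightarrow> real \<Rightarrow> real" where
  "dil_fun \<phi> s = (SUP t\<in>{0<..min 1 (1/s)}. \<phi> (s * t) / \<phi> t)"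

end

theory Submission
  imports Defs
begin

text \<open>
  Write \<open>F x\<close> for the integral of \<open>\<bar>f\<bar>\<close> over \<open>{0..x}\<close> and \<open>G x = F x / x\<close> for its Cesaro mean.
  The rearrangement \<open>G*\<close> is compared pointwise with integrals of \<open>\<bar>f\<bar>\<close> against explicit kernels,
  and Tonelli's theorem for \<open>d\<phi> \<otimes> dt\<close> turns these comparisons into comparisons of weights.

  Upper bound: \<open>G* s\<close> is at most the supremum of \<open>G\<close> over \<open>{s/2..1 - s/2}\<close>, hence at most the
  integral of \<open>\<bar>f t\<bar> * 3 / (s + t)\<close> over \<open>t \<le> 1 - s/2\<close>. Concavity of \<open>\<phi>\<close> bounds the \<open>d\<phi>\<close>-integral of
  \<open>1 / (s + t)\<close> over \<open>s \<le> 2 (1 - t)\<close> by \<open>2 w t\<close>.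

  Lower bound: \<open>F\<close> is increasing, so \<open>G \<ge> F s / (3 s)\<close> on \<open>{s..3 s}\<close> and \<open>G \<ge> F (1 - 2 s)\<close> on
  \<open>{1 - 2 s..1}\<close>. Both sets have measure \<open>2 s > s\<close>, so \<open>G* s\<close> dominates both constants. This
  controls the weights \<open>\<integral> d\<phi>(s) / s\<close> over \<open>{t..1/3}\<close> and \<open>\<phi> (1 - t)\<close>, and the positive lower index
  shows that their sum dominates \<open>w t\<close>.
\<close>

text \<open>Cut \<open>{a..b}\<close> into \<open>n\<close> equal pieces: the drops of
  \<open>r\<close> telescope, so \<open>\<bar>D b - D a\<bar>\<close> is at most
  \<open>(b - a) * (r a - r b) / n\<close> for every \<open>n\<close>. It identifies an integral of
  a monotone function with an increment of \<open>\<phi>\<close>, with no differentiability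
  needed.\<close>

lemma eq_ends_of_increment_bound:
  fixes D r :: "real \<Rightarrow> real"
  assumes "a \<le> b"
    and bound: "\<And>x y. a \<le> x \<Longrightarrow> x \<le> y \<Longrightarrow> y \<le> b \<Longrightarrow> \<bar>D y - D x\<bar> \<le> (y - x) * (r x - r y)"
  shows "D a = D b"
proof -
  have n_bound: "real n * \<bar>D b - D a\<bar> \<le> (b - a) * (r a - r b)" if "n > 0" for n :: nat
  proof -
    define h where "h = (b - a) / n"
    define x where "x i = a + real i * h" for i :: nat
    have h: "0 \<le> h" "real n * h = b - a" using that \<open>a \<le> b\<close> by (auto simp: h_def)
    have x0: "x 0 = a" and xn: "x n = b" by (auto simp: x_def h)
    have step: "\<bar>D (x (Suc i)) - D (x i)\<bar> \<le> h * (r (x i) - r (x (Suc i)))" if "i < n" for i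
    proof -
      have "real (Suc i) * h \<le> real n * h"
        using that h(1) by (intro mult_right_mono) auto
      then have "x (Suc i) \<le> b" by (simp add: x_def h)
      moreover have "a \<le> x i" "x i \<le> x (Suc i)" "x (Suc i) - x i = h"
        using h(1) by (auto simp: x_def algebra_simps)
      ultimately show ?thesis using bound[of "x i" "x (Suc i)"] by simp
    qed
    have "D b - D a = (\<Sum>i<n. D (x (Suc i)) - D (x i))"
      using sum_lessThan_telescope[of "\<lambda>i. D (x i)" n] by (simp add: x0 xn)
    also have "\<bar>\<dots>\<bar> \<le> (\<Sum>i<n. h * (r (x i) - r (x (Suc i))))"
      by (rule order_trans[OF sum_abs sum_mono]) (use step in auto)
    also have "\<dots> = h * (r a - r b)"
      using sum_lessThan_telescope'[of "\<lambda>i. r (x i)" n] by (simp add: x0 xn flip: sum_distrib_left)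
    finally have "real n * \<bar>D b - D a\<bar> \<le> real n * (h * (r a - r b))"
      by (intro mult_left_mono) auto
    then show ?thesis by (simp add: h flip: mult.assoc)
  qed
  have "\<not> \<bar>D b - D a\<bar> > 0"
  proof
    assume "\<bar>D b - D a\<bar> > 0"
    then obtain n :: nat where "(b - a) * (r a - r b) < real n * \<bar>D b - D a\<bar>"
      using reals_Archimedean3 by blast
    then have "(b - a) * (r a - r b) < real (Suc n) * \<bar>D b - D a\<bar>"
      by (simp add: algebra_simps)
    then show False using n_bound[of "Suc n"] by auto
  qed
  then show ?thesis by auto
qed

section \<open>Concave weights: growth and continuity\<close>

text \<open>\<open>small_dilation\<close> is the form in which the positive lower index is used: it
  rules out a jump of \<open>\<phi>\<close> at 0 and supplies the growth needed in
  \<open>kernel_lower\<close>.\<close>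

locale concave_weight =
  fixes \<phi> :: "real \<Rightarrow> real"
  assumes incr: "mono_on {0..1} \<phi>"
    and conc: "concave_on {0..1} \<phi>"
    and zero: "\<phi> 0 = 0"
    and pos: "\<And>t. 0 < t \<Longrightarrow> t \<le> 1 \<Longrightarrow> 0 < \<phi> t"
    and small_dilation:
      "\<And>e. 0 < e \<Longrightarrow> \<exists>s\<in>{0<..<1}. \<forall>t\<in>{0<..1}. \<phi> (s * t) \<le> e * \<phi> t"
begin

lemma mono: "0 \<le> x \<Longrightarrow> x \<le> y \<Longrightarrow> y \<le> 1 \<Longrightarrow> \<phi> x \<le> \<phi> y"
  using incr by (auto simp: mono_on_def)

lemma nonneg: "0 \<le> x \<Longrightarrow> x \<le> 1 \<Longrightarrow> 0 \<le> \<phi> x"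
  using mono[of 0 x] zero by simp

lemma three_point:
  assumes "0 \<le> x" "x < y" "y < z" "z \<le> 1"
  shows "(z - y) * \<phi> x + (y - x) * \<phi> z \<le> (z - x) * \<phi> y"
proof -
  define t where "t = (y - x) / (z - x)"
  have t: "0 \<le> t" "t \<le> 1" "t * (z - x) = y - x" using assms by (auto simp: t_def)
  have "(1 - t) * x + t * z = y" using t(3) by (simp add: algebra_simps)
  then have "(1 - t) * \<phi> x + t * \<phi> z \<le> \<phi> y"
    using concave_onD[OF conc t(1,2), of x z] assms by simp
  then have "(z - x) * ((1 - t) * \<phi> x + t * \<phi> z) \<le> (z - x) * \<phi> y"
    using assms by (intro mult_left_mono) auto
  moreover have "(z - x) * ((1 - t) * \<phi> x + t * \<phi> z)
      = ((z - x) - t * (z - x)) * \<phi> x + (t * (z - x)) * \<phi> z" by (simp add: algebra_simps)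
  ultimately show ?thesis by (simp add: t(3))
qed

text \<open>Chords from the origin have decreasing slope; the product form also covers
  \<open>x = 0\<close>.\<close>

lemma star_shaped:
  assumes "0 \<le> x" "x \<le> y" "y \<le> 1"
  shows "x * \<phi> y \<le> y * \<phi> x"
  using three_point[of 0 x y] assms zero by (cases "x = 0 \<or> x = y") auto

lemma doubling:
  assumes "0 \<le> a" "a \<le> b" "b \<le> 1" "b \<le> 2 * a"
  shows "\<phi> b \<le> 2 * \<phi> a"
proof (cases "a = 0")
  case False
  have "a * \<phi> b \<le> b * \<phi> a" using star_shaped assms by auto
  also have "\<dots> \<le> 2 * a * \<phi> a" using assms nonneg[of a] by (intro mult_right_mono) auto
  finally have "a * \<phi> b \<le> a * (2 * \<phi> a)" by simp
  then show ?thesis using False assms by simp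
qed (use assms zero in auto)

text \<open>At a point \<open>x > 0\<close>, \<open>star_shaped\<close> and monotonicity give a
  Lipschitz bound with constant \<open>\<phi> 1 / x\<close>. At 0 concavity alone permits a jump,
  which \<open>small_dilation\<close> excludes.\<close>

lemma continuous: "continuous_on {0..1} \<phi>"
  unfolding continuous_on_iff
proof (intro ballI allI impI)
  fix x e :: real assume x: "x \<in> {0..1}" and e: "0 < e"
  show "\<exists>d>0. \<forall>y\<in>{0..1}. dist y x < d \<longrightarrow> dist (\<phi> y) (\<phi> x) < e"
  proof (cases "x = 0")
    case True
    have p1: "0 < \<phi> 1" using pos[of 1] by simp
    obtain s where s: "0 < s" "s < 1" "\<forall>t\<in>{0<..1}. \<phi> (s * t) \<le> (e / (2 * \<phi> 1)) * \<phi> t"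
      using small_dilation[of "e / (2 * \<phi> 1)"] e p1 by auto
    have "\<phi> s \<le> e / 2" using s(3)[rule_format, of 1] p1 by simp
    then have "\<phi> s < e" using e by simp
    then have "dist (\<phi> y) (\<phi> x) < e" if "y \<in> {0..1}" "dist y x < s" for y
      using that True mono[of y s] nonneg[of y] s zero by (auto simp: dist_real_def)
    then show ?thesis using s(1) by blast
  next
    case False
    then have x': "0 < x" "x \<le> 1" using x by auto
    have p1: "0 < \<phi> 1" using pos[of 1] by simp
    define d where "d = e * x / \<phi> 1"
    have d: "d > 0" using e x' p1 by (simp add: d_def)
    \<comment> \<open>The base point may be the left or the right end of the increment, so the bound
      is needed with either end as factor.\<close>
    have ordered: "u * (\<phi> v - \<phi> u) \<le> (v - u) * \<phi> 1" "0 \<le> \<phi> v - \<phi> u"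
      "v * (\<phi> v - \<phi> u) \<le> (v - u) * \<phi> 1" if "0 \<le> u" "u \<le> v" "v \<le> 1" for u v
    proof -
      have 1: "v * (\<phi> v - \<phi> u) \<le> (v - u) * \<phi> v"
        using star_shaped[OF that] by (simp add: algebra_simps)
      also have "\<dots> \<le> (v - u) * \<phi> 1" using that mono[of v 1] by (intro mult_left_mono) auto
      finally show 2: "v * (\<phi> v - \<phi> u) \<le> (v - u) * \<phi> 1" .
      show 3: "0 \<le> \<phi> v - \<phi> u" using mono that by auto
      have "u * (\<phi> v - \<phi> u) \<le> v * (\<phi> v - \<phi> u)" using that 3 by (intro mult_right_mono) auto
      with 2 show "u * (\<phi> v - \<phi> u) \<le> (v - u) * \<phi> 1" by simp
    qed
    have "dist (\<phi> y) (\<phi> x) < e" if y: "y \<in> {0..1}" "dist y x < d" for y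
    proof -
      have "x * \<bar>\<phi> y - \<phi> x\<bar> \<le> \<bar>y - x\<bar> * \<phi> 1"
        using ordered[of x y] ordered[of y x] x' y by (cases "x \<le> y") auto
      also have "\<dots> < d * \<phi> 1" using y p1 by (auto simp: dist_real_def)
      also have "\<dots> = x * e" using p1 by (simp add: d_def)
      finally show ?thesis using x' by (simp add: dist_real_def)
    qed
    then show ?thesis using d by blast
  qed
qed

section \<open>The Stieltjes measure of the weight\<close>

text \<open>This is the integrator inside \<open>stieltjes_phi\<close>; extending
  \<open>\<phi>\<close> by constants makes it monotone and continuous on the whole line, as
  \<open>interval_measure\<close> requires.\<close>

definition clamped :: "real \<Rightarrow> real" where
  "clamped t = \<phi> (max 0 (min 1 t))"

lemma clamped_mono: "x \<le> y \<Longrightarrow> clamped x \<le> clamped y"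
  unfolding clamped_def by (intro mono) auto

lemma clamped_eq: "0 \<le> x \<Longrightarrow> x \<le> 1 \<Longrightarrow> clamped x = \<phi> x"
  by (simp add: clamped_def)

lemma clamped_continuous: "continuous_on UNIV clamped"
  unfolding clamped_def
  by (rule continuous_on_compose2[OF continuous]) (auto intro!: continuous_intros)

lemma clamped_continuous_right: "continuous (at_right a) clamped"
  using clamped_continuous by (simp add: continuous_on_eq_continuous_at continuous_at_imp_continuous_at_within)

abbreviation \<nu> :: "real measure" where "\<nu> \<equiv> stieltjes_phi \<phi>"

lemma \<nu>_clamped: "\<nu> = interval_measure clamped"
  by (simp add: stieltjes_phi_def clamped_def[abs_def])

lemma sets_\<nu> [simp, measurable_cong]: "sets \<nu> = sets borel"
  by (simp add: stieltjes_phi_def)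

lemma space_\<nu> [simp]: "space \<nu> = UNIV"
  by (simp add: stieltjes_phi_def)

lemma sigma_finite_\<nu>: "sigma_finite_measure \<nu>"
  unfolding \<nu>_clamped by (rule sigma_finite_interval_measure[OF clamped_mono clamped_continuous_right])

lemma emeasure_\<nu>_Ioc: "a \<le> b \<Longrightarrow> emeasure \<nu> {a<..b} = ennreal (clamped b - clamped a)"
  unfolding \<nu>_clamped by (rule emeasure_interval_measure_Ioc[OF _ clamped_mono clamped_continuous_right])

lemma emeasure_\<nu>_Icc: "a \<le> b \<Longrightarrow> emeasure \<nu> {a..b} = ennreal (clamped b - clamped a)"
  unfolding \<nu>_clamped by (rule emeasure_interval_measure_Icc[OF _ clamped_mono clamped_continuous])

section \<open>One-sided slopes and the density of the Stieltjes measure\<close>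

definition slope :: "real \<Rightarrow> real \<Rightarrow> real" where
  "slope x y = (\<phi> y - \<phi> x) / (y - x)"

text \<open>For \<open>0 < x < 1\<close> this is the right derivative of \<open>\<phi>\<close>,
  since chord slopes grow as \<open>y\<close> decreases to \<open>x\<close>. At 0 the slopes may be
  unbounded, so the lemmas stay at interior points.\<close>

definition right_slope :: "real \<Rightarrow> real" where
  "right_slope x = (SUP y\<in>{x<..1}. slope x y)"

lemma slope_decreasing:
  assumes "0 \<le> x" "x < y" "y < z" "z \<le> 1"
  shows "slope y z \<le> slope x y"
  using three_point[OF assms] assms
  by (simp add: slope_def divide_simps algebra_simps)

lemma slope_le_right_slope:
  assumes "0 < x" "x < y" "y \<le> 1"
  shows "slope x y \<le> right_slope x"
  unfolding right_slope_def
proof (rule cSUP_upper)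
  \<comment> \<open>A chord ending at \<open>x\<close> is at least as steep as every chord starting
    there; the one from 0 exists because \<open>0 < x\<close>.\<close>
  show "bdd_above (slope x ` {x<..1})"
    using slope_decreasing[of 0 x] assms by (auto simp: bdd_above_def intro!: exI[of _ "slope 0 x"])
qed (use assms in auto)

lemma right_slope_le_slope:
  assumes "0 \<le> x" "x < y" "y < 1"
  shows "right_slope y \<le> slope x y"
  unfolding right_slope_def
  by (rule cSUP_least) (use assms slope_decreasing[of x y] in auto)

lemma right_slope_nonneg: "0 < x \<Longrightarrow> x < 1 \<Longrightarrow> 0 \<le> right_slope x"
  using slope_le_right_slope[of x 1] mono[of x 1] by (auto simp: slope_def intro: order_trans[rotated])

lemma right_slope_antimono:
  assumes "0 < x" "x \<le> y" "y < 1"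
  shows "right_slope y \<le> right_slope x"
  using slope_le_right_slope[of x y] right_slope_le_slope[of x y] assms by (cases "x = y") auto

lemma increment_between_right_slopes:
  assumes "0 < x" "x \<le> y" "y < 1"
  shows "(y - x) * right_slope y \<le> \<phi> y - \<phi> x" "\<phi> y - \<phi> x \<le> (y - x) * right_slope x"
  using slope_le_right_slope[of x y] right_slope_le_slope[of x y] assms
  by (cases "x = y"; simp add: slope_def field_simps)+

text \<open>The chord slope between \<open>x\<close> and \<open>y\<close> lies between
  \<open>right_slope x\<close> and \<open>right_slope y\<close>, so continuity of
  \<open>right_slope\<close> at \<open>x\<close> squeezes the difference quotients.\<close>

lemma deriv_eq_right_slope:
  assumes x: "0 < x" "x < 1" and c: "isCont right_slope x"
  shows "deriv \<phi> x = right_slope x"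
proof (rule DERIV_imp_deriv)
  have lim: "(right_slope \<longlongrightarrow> right_slope x) (at x)" using c by (simp add: isCont_def)
  \<comment> \<open>Minimum and maximum treat \<open>y < x\<close> and \<open>y > x\<close> at once,
    avoiding two one-sided limits.\<close>
  define lo where "lo y = min (right_slope x) (right_slope y)" for y
  define hi where "hi y = max (right_slope x) (right_slope y)" for y
  have nhd: "\<forall>\<^sub>F y in at x. y \<in> {0<..<1}"
    using x by (intro eventually_at_in_open') auto
  have "((\<lambda>y. (\<phi> y - \<phi> x) / (y - x)) \<longlongrightarrow> right_slope x) (at x)"
  proof (rule tendsto_sandwich)
    show "(lo \<longlongrightarrow> right_slope x) (at x)" "(hi \<longlongrightarrow> right_slope x) (at x)"
      unfolding lo_def hi_def using tendsto_min[OF tendsto_const lim, of "right_slope x"]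
        tendsto_max[OF tendsto_const lim, of "right_slope x"] by auto
    have *: "lo y \<le> slope x y \<and> slope x y \<le> hi y" if y: "y \<in> {0<..<1}" "y \<noteq> x" for y
    proof (cases "x < y")
      case True
      then show ?thesis
        using slope_le_right_slope[of x y] right_slope_le_slope[of x y] x y
        by (auto simp: lo_def hi_def)
    next
      case False
      have "slope x y = slope y x" unfolding slope_def by (metis minus_diff_eq minus_divide_divide)
      then show ?thesis
        using False slope_le_right_slope[of y x] right_slope_le_slope[of y x] x y
        by (auto simp: lo_def hi_def)
    qed
    have "\<forall>\<^sub>F y in at x. y \<in> {0<..<1} \<and> y \<noteq> x"
      using nhd by (auto simp: eventually_conj_iff eventually_at_filter)
    then show "\<forall>\<^sub>F y in at x. lo y \<le> (\<phi> y - \<phi> x) / (y - x)"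
      "\<forall>\<^sub>F y in at x. (\<phi> y - \<phi> x) / (y - x) \<le> hi y"
      by (eventually_elim; use * in \<open>auto simp: slope_def\<close>)+
  qed
  then show "(\<phi> has_real_derivative right_slope x) (at x)"
    by (simp add: has_field_derivative_iff)
qed

text \<open>A monotone function has only countably many discontinuities. This links the
  \<open>deriv\<close> in \<open>weight\<close> to the density of \<open>\<nu>\<close>.\<close>

lemma AE_deriv_eq_right_slope:
  "AE x in lborel. x \<in> {0<..<1} \<longrightarrow> deriv \<phi> x = right_slope x"
proof -
  have "mono_on {0<..<1} (\<lambda>x. - right_slope x)"
    using right_slope_antimono by (auto simp: mono_on_def)
  from mono_on_ctble_discont_open[OF _ this]
  have "countable {x\<in>{0<..<1}. \<not> isCont (\<lambda>x. - right_slope x) x}" by simp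
  then have "AE x in lborel. x \<notin> {x\<in>{0<..<1}. \<not> isCont (\<lambda>x. - right_slope x) x}"
    by (intro AE_not_in countable_imp_null_set_lborel)
  then show ?thesis
  proof eventually_elim
    case (elim x)
    then show ?case
      using deriv_eq_right_slope[of x] isCont_minus[of x "\<lambda>x. - right_slope x"] by auto
  qed
qed

definition density_fun :: "real \<Rightarrow> real" where
  "density_fun x = (if x \<in> {0<..<1} then right_slope x else 0)"

lemma density_fun_measurable [measurable]: "density_fun \<in> borel_measurable borel"
proof -
  have "mono_on {0<..<1} (\<lambda>x. - right_slope x)"
    using right_slope_antimono by (auto simp: mono_on_def)
  from borel_measurable_mono_on_fnc[OF this]
  have "(\<lambda>x. - (- right_slope x)) \<in> borel_measurable (restrict_space borel {0<..<1})"
    by (rule borel_measurable_uminus)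
  moreover have "{x. 0 < x \<and> x < 1} = {0<..<(1::real)}" by auto
  ultimately show ?thesis
    unfolding density_fun_def
    by (intro measurable_If_restrict_space_iff[THEN iffD2]) simp_all
qed

text \<open>On each \<open>{x..y}\<close> both the integral and the increment of
  \<open>\<phi>\<close> lie between \<open>(y - x) * right_slope y\<close> and
  \<open>(y - x) * right_slope x\<close>, so their difference meets
  \<open>eq_ends_of_increment_bound\<close>.\<close>

lemma has_integral_right_slope:
  assumes "0 < a" "a \<le> b" "b < 1"
  shows "(right_slope has_integral (\<phi> b - \<phi> a)) {a..b}"
proof -
  have int: "right_slope integrable_on {x..y}" if "a \<le> x" "y \<le> b" for x y
  proof -
    have "mono_on {x..y} (\<lambda>x. - right_slope x)"
      using right_slope_antimono assms that by (auto simp: mono_on_def)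
    then have "(\<lambda>x. - right_slope x) integrable_on {x..y}"
      by (rule integrable_on_mono_on)
    then show ?thesis using integrable_neg_iff by blast
  qed
  define D where "D x = integral {a..x} right_slope - \<phi> x" for x
  have "D a = D b"
  proof (rule eq_ends_of_increment_bound[where D = D and a = a and b = b and r = right_slope])
    fix x y assume xy: "a \<le> x" "x \<le> y" "y \<le> b"
    have split: "integral {a..y} right_slope - integral {a..x} right_slope = integral {x..y} right_slope"
      using Henstock_Kurzweil_Integration.integral_combine[of a x y right_slope] xy int by auto
    have "integral {x..y} (\<lambda>_. right_slope y) \<le> integral {x..y} right_slope"
      using xy assms int by (intro integral_le) (auto intro!: right_slope_antimono)
    moreover have "integral {x..y} right_slope \<le> integral {x..y} (\<lambda>_. right_slope x)"
      using xy assms int by (intro integral_le) (auto intro!: right_slope_antimono)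
    ultimately have "(y - x) * right_slope y \<le> integral {x..y} right_slope"
      "integral {x..y} right_slope \<le> (y - x) * right_slope x" using xy by auto
    then show "\<bar>D y - D x\<bar> \<le> (y - x) * (right_slope x - right_slope y)"
      using increment_between_right_slopes[of x y] xy assms split
      by (simp add: D_def abs_le_iff algebra_simps)
  qed fact
  then have "integral {a..b} right_slope = \<phi> b - \<phi> a" by (simp add: D_def)
  then show ?thesis using int[of a b] by (simp add: has_integral_iff)
qed

lemma density_fun_nonneg: "0 \<le> density_fun x"
  by (auto simp: density_fun_def right_slope_nonneg)

lemma nn_integral_density_fun_inner:
  assumes "0 < a" "a \<le> b" "b < 1"
  shows "(\<integral>\<^sup>+x. ennreal (density_fun x) * indicator {a<..b} x \<partial>lborel) = ennreal (\<phi> b - \<phi> a)"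
proof -
  have "(density_fun has_integral (\<phi> b - \<phi> a)) {a..b}"
    using has_integral_right_slope[OF assms] assms
    by (subst has_integral_cong[where g = right_slope]) (auto simp: density_fun_def)
  from nn_integral_has_integral_lebesgue'[OF density_fun_nonneg this]
  have "(\<integral>\<^sup>+x. ennreal (density_fun x) * indicator {a..b} x \<partial>lborel) = ennreal (\<phi> b - \<phi> a)" .
  moreover have "(\<integral>\<^sup>+x. ennreal (density_fun x) * indicator {a..b} x \<partial>lborel)
      = (\<integral>\<^sup>+x. ennreal (density_fun x) * indicator {a<..b} x \<partial>lborel)"
  proof (rule nn_integral_cong_AE)
    show "AE x in lborel. ennreal (density_fun x) * indicator {a..b} x
        = ennreal (density_fun x) * indicator {a<..b} x"
      using AE_lborel_singleton[of a] by eventually_elim (auto simp: indicator_def)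
  qed
  ultimately show ?thesis by simp
qed

text \<open>The ends 0 and 1 are reached by exhausting from inside: continuity from below of the
  measure on one side, continuity of \<open>\<phi>\<close> on the other.\<close>

lemma nn_integral_density_fun_Ioo:
  assumes "0 \<le> a" "a \<le> b" "b \<le> 1"
  shows "(\<integral>\<^sup>+x. ennreal (density_fun x) * indicator {a<..<b} x \<partial>lborel) = ennreal (\<phi> b - \<phi> a)"
proof (cases "a = b")
  case False
  then have "a < b" using assms by simp
  define h where "h n = (b - a) / (2 * real (Suc n))" for n
  have h: "0 < h n" "2 * h n \<le> b - a" for n
    using \<open>a < b\<close> by (auto simp: h_def field_simps intro!: mult_right_mono)
  have h_lim: "h \<longlonglongrightarrow> 0"
    unfolding h_def using tendsto_mult[OF tendsto_const[of "(b - a) / 2"] LIMSEQ_inverse_real_of_nat]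
    by (simp add: field_simps)
  have h_dec: "h n \<le> h m" if "m \<le> n" for m n
    unfolding h_def using that \<open>a < b\<close> by (intro divide_left_mono) auto
  define A where "A n = {a + h n<..b - h n}" for n
  have AU: "(\<Union>n. A n) = {a<..<b}"
  proof (intro equalityI subsetI)
    fix x assume x: "x \<in> {a<..<b}"
    then have "\<forall>\<^sub>F n in sequentially. h n < min (x - a) (b - x)"
      using order_tendstoD(2)[OF h_lim, of "min (x - a) (b - x)"] by auto
    then obtain n where "h n < min (x - a) (b - x)"
      by (auto simp: eventually_sequentially)
    then show "x \<in> (\<Union>n. A n)" by (auto simp: A_def intro!: exI[of _ n])
  next
    fix x assume "x \<in> (\<Union>n. A n)"
    then obtain n where "x \<in> A n" by auto
    then show "x \<in> {a<..<b}" using h(1)[of n] by (auto simp: A_def)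
  qed
  have inc: "incseq A"
    unfolding incseq_def A_def using h_dec by fastforce
  define N where "N = density lborel (\<lambda>x. ennreal (density_fun x))"
  have Nem: "emeasure N X = (\<integral>\<^sup>+x. ennreal (density_fun x) * indicator X x \<partial>lborel)"
    if "X \<in> sets borel" for X
    using that by (simp add: N_def emeasure_density)
  have "(\<lambda>n. emeasure N (A n)) \<longlonglongrightarrow> emeasure N (\<Union>n. A n)"
  proof (rule Lim_emeasure_incseq[OF _ inc])
    show "range A \<subseteq> sets N" by (auto simp: N_def A_def)
  qed
  moreover have "emeasure N (A n) = ennreal (\<phi> (b - h n) - \<phi> (a + h n))" for n
  proof -
    have "0 < a + h n" "a + h n \<le> b - h n" "b - h n < 1" using h[of n] assms by auto
    from nn_integral_density_fun_inner[OF this] show ?thesis by (simp add: Nem A_def)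
  qed
  moreover have "(\<lambda>n. ennreal (\<phi> (b - h n) - \<phi> (a + h n))) \<longlonglongrightarrow> ennreal (\<phi> b - \<phi> a)"
  proof (intro tendsto_ennrealI tendsto_diff)
    have "(\<lambda>n. clamped (b - h n)) \<longlonglongrightarrow> clamped (b - 0)" "(\<lambda>n. clamped (a + h n)) \<longlonglongrightarrow> clamped (a + 0)"
      using clamped_continuous
      by (intro isCont_tendsto_compose[where g = clamped] tendsto_intros h_lim;
          simp add: continuous_on_eq_continuous_at)+
    moreover have "clamped (b - h n) = \<phi> (b - h n)" "clamped (a + h n) = \<phi> (a + h n)" for n
      using h[of n] assms by (auto intro!: clamped_eq)
    ultimately show "(\<lambda>n. \<phi> (b - h n)) \<longlonglongrightarrow> \<phi> b" "(\<lambda>n. \<phi> (a + h n)) \<longlonglongrightarrow> \<phi> a"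
      using assms by (simp_all add: clamped_eq)
  qed
  ultimately have "emeasure N (\<Union>n. A n) = ennreal (\<phi> b - \<phi> a)"
    by (simp add: LIMSEQ_unique)
  then show ?thesis by (simp add: AU Nem)
qed auto

text \<open>Both measures agree on half-open intervals, which form an intersection-stable generator
  of the Borel sets, and are finite on a countable cover.\<close>

lemma \<nu>_density: "\<nu> = density lborel (\<lambda>x. ennreal (density_fun x))" (is "_ = ?N")
proof (rule measure_eqI_generator_eq_countable)
  let ?E = "range (\<lambda>(a, b). {a<..b::real})"
  let ?A = "range (\<lambda>n::nat. {- real n<..real n})"
  show "Int_stable ?E"
  proof (rule Int_stableI_image)
    fix i j :: "real \<times> real"
    show "\<exists>k\<in>UNIV. (case i of (a, b) \<Rightarrow> {a<..b}) \<inter> (case j of (a, b) \<Rightarrow> {a<..b}) = (case k of (a, b) \<Rightarrow> {a<..b})"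
      by (intro bexI[of _ "(max (fst i) (fst j), min (snd i) (snd j))"]) (auto split: prod.split)
  qed
  show "?E \<subseteq> Pow UNIV" by auto
  show "sets \<nu> = sigma_sets UNIV ?E" "sets ?N = sigma_sets UNIV ?E"
    by (auto simp: borel_sigma_sets_Ioc)
  show "?A \<subseteq> ?E" by auto
  show "countable ?A" by simp
  show "\<Union> ?A = UNIV"
  proof (intro equalityI subsetI UNIV_I)
    fix x :: real
    obtain n where "\<bar>x\<bar> < real n" using reals_Archimedean2 by blast
    then show "x \<in> \<Union> ?A" by (auto intro!: exI[of _ n])
  qed
  show "emeasure \<nu> X \<noteq> \<infinity>" if "X \<in> ?A" for X
    using that by (auto simp: emeasure_\<nu>_Ioc)
  fix X assume "X \<in> ?E"
  then obtain a b where X: "X = {a<..b}" by auto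
  show "emeasure \<nu> X = emeasure ?N X"
  proof (cases "a \<le> b")
    case True
    \<comment> \<open>Outside \<open>{0..1}\<close> the density vanishes and \<open>clamped\<close>
      is constant, so both sides depend only on the clamped ends.\<close>
    define a' b' where "a' = max 0 (min 1 a)" and "b' = max 0 (min 1 b)"
    have "emeasure ?N X = (\<integral>\<^sup>+x. ennreal (density_fun x) * indicator {a<..b} x \<partial>lborel)"
      by (simp add: X emeasure_density)
    also have "\<dots> = (\<integral>\<^sup>+x. ennreal (density_fun x) * indicator {a'<..<b'} x \<partial>lborel)"
    proof (rule nn_integral_cong_AE)
      show "AE x in lborel. ennreal (density_fun x) * indicator {a<..b} x
          = ennreal (density_fun x) * indicator {a'<..<b'} x"
        using AE_lborel_singleton[of b]
        by eventually_elim (auto simp: indicator_def density_fun_def a'_def b'_def)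
    qed
    also have "\<dots> = ennreal (\<phi> b' - \<phi> a')"
      using True by (intro nn_integral_density_fun_Ioo) (auto simp: a'_def b'_def)
    finally show ?thesis using True by (simp add: X emeasure_\<nu>_Ioc clamped_def a'_def b'_def)
  qed (simp add: X)
qed

text \<open>Allows the rearrangement bounds, which require \<open>0 < s\<close>, to be integrated
  over \<open>{0..1}\<close>.\<close>

lemma AE_\<nu>_pos: "AE s in \<nu>. 0 < s"
  unfolding \<nu>_density
  by (subst AE_density) (simp, auto simp: density_fun_def)

text \<open>The weight as an integral against \<open>\<nu>\<close>, the shape that Tonelli's theorem
  produces.\<close>

definition W :: "real \<Rightarrow> ennreal" where
  "W t = (\<integral>\<^sup>+s. ennreal (1 / (t + s)) * indicator {0..1 - t} s \<partial>\<nu>)"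

lemma weight_eq_W:
  assumes "0 < t"
  shows "weight \<phi> t = W t"
proof -
  have "W t = (\<integral>\<^sup>+s. ennreal (density_fun s) * (ennreal (1 / (t + s)) * indicator {0..1 - t} s) \<partial>lborel)"
    unfolding W_def \<nu>_density by (rule nn_integral_density) auto
  also have "\<dots> = (\<integral>\<^sup>+s\<in>{0..1-t}. ennreal (deriv \<phi> s / (t + s)) \<partial>lborel)"
  proof (rule nn_integral_cong_AE)
    show "AE s in lborel. ennreal (density_fun s) * (ennreal (1 / (t + s)) * indicator {0..1 - t} s)
        = ennreal (deriv \<phi> s / (t + s)) * indicator {0..1 - t} s"
      using AE_deriv_eq_right_slope AE_lborel_singleton[of 0] AE_lborel_singleton[of "1::real"]
    proof eventually_elim
      case (elim s)
      show ?case
      proof (cases "s \<in> {0..1 - t}")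
        case True
        then have "s \<in> {0<..<1}" using elim assms by auto
        then have "density_fun s = deriv \<phi> s" using elim by (simp add: density_fun_def)
        then show ?thesis using True assms density_fun_nonneg[of s]
          by (simp flip: ennreal_mult)
      qed auto
    qed
  qed
  also have "\<dots> = weight \<phi> t"
    by (simp add: weight_def nn_integral_completion)
  finally show ?thesis by simp
qed

end

section \<open>Pointwise bounds for the rearranged Cesaro mean\<close>

lemma decr_rearr_le:
  assumes X: "X \<in> sets lebesgue" "emeasure lebesgue X \<le> ennreal s"
    and le: "\<And>x. x \<in> {0..1} \<Longrightarrow> x \<notin> X \<Longrightarrow> G x \<le> c"
  shows "decr_rearr G s \<le> c"
  unfolding decr_rearr_def
proof (rule Inf_lower, rule CollectI)
  have "{x \<in> {0..1}. c < G x} \<subseteq> X" using le by (auto simp: not_le[symmetric])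
  then have "emeasure lebesgue {x \<in> {0..1}. c < G x} \<le> emeasure lebesgue X"
    by (rule emeasure_mono[OF _ X(1)])
  with X(2) show "emeasure lebesgue {x \<in> {0..1}. c < G x} \<le> ennreal s" by simp
qed

text \<open>Any \<open>y\<close> below \<open>c\<close> has a superlevel set containing
  \<open>X\<close>. The measure of \<open>X\<close> must exceed \<open>s\<close> strictly, since the
  infimum admits levels whose superlevel set has measure exactly \<open>s\<close>.\<close>

lemma le_decr_rearr:
  assumes G [measurable]: "G \<in> borel_measurable borel"
    and X: "X \<subseteq> {0..1}" "ennreal s < emeasure lebesgue X"
    and le: "\<And>x. x \<in> X \<Longrightarrow> c \<le> G x"
  shows "c \<le> decr_rearr G s"
  unfolding decr_rearr_def
proof (rule Inf_greatest, rule ccontr)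
  fix y assume y: "y \<in> {y. emeasure lebesgue {x \<in> {0..1}. y < G x} \<le> ennreal s}" and "\<not> c \<le> y"
  then have sub: "X \<subseteq> {x \<in> {0..1}. y < G x}" using X(1) le by fastforce
  have "{x \<in> {0..1}. y < G x} \<in> sets borel" by measurable
  then have "{x \<in> {0..1}. y < G x} \<in> sets lebesgue" by simp
  then have "emeasure lebesgue X \<le> emeasure lebesgue {x \<in> {0..1}. y < G x}"
    by (rule emeasure_mono[OF sub])
  with X(2) y show False by auto
qed

lemma decr_rearr_cong:
  assumes "\<And>x. x \<in> {0..1} \<Longrightarrow> G x = H x"
  shows "decr_rearr G = decr_rearr H"
proof -
  have "{x \<in> {0..1}. y < G x} = {x \<in> {0..1}. y < H x}" for y using assms by auto
  then show ?thesis by (simp add: decr_rearr_def fun_eq_iff)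
qed

text \<open>With \<open>cesaro\<close>, this mirrors \<open>cesaro_abs\<close> for extended-valued
  integrands and \<open>lborel\<close>, where Borel measurability and Tonelli's theorem are at
  hand.\<close>

definition primitive :: "(real \<Rightarrow> ennreal) \<Rightarrow> real \<Rightarrow> ennreal" where
  "primitive g x = (\<integral>\<^sup>+t. g t * indicator {0..x} t \<partial>lborel)"

definition cesaro :: "(real \<Rightarrow> ennreal) \<Rightarrow> real \<Rightarrow> ennreal" where
  "cesaro g x = primitive g x / ennreal x"

lemma primitive_mono: "x \<le> y \<Longrightarrow> primitive g x \<le> primitive g y"
  unfolding primitive_def by (intro nn_integral_mono mult_left_mono) (auto simp: indicator_def)

lemma primitive_measurable [measurable]:
  assumes [measurable]: "g \<in> borel_measurable borel"
  shows "primitive g \<in> borel_measurable borel"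
proof -
  \<comment> \<open>As a conditional, the \<open>x\<close>-dependent interval becomes a jointly
    measurable function of \<open>x\<close> and \<open>t\<close>.\<close>
  have "(\<lambda>x. \<integral>\<^sup>+t. g t * (if 0 \<le> t \<and> t \<le> x then 1 else 0) \<partial>lborel) \<in> borel_measurable borel"
    by measurable
  also have "(\<lambda>x. \<integral>\<^sup>+t. g t * (if 0 \<le> t \<and> t \<le> x then 1 else 0) \<partial>lborel) = primitive g"
    by (intro ext, unfold primitive_def, intro nn_integral_cong) (auto simp: indicator_def)
  finally show ?thesis .
qed

lemma cesaro_measurable [measurable]:
  assumes [measurable]: "g \<in> borel_measurable borel"
  shows "cesaro g \<in> borel_measurable borel"
  unfolding cesaro_def[abs_def] by measurable

lemma cesaro_eq: "0 < x \<Longrightarrow> cesaro g x = primitive g x * ennreal (1 / x)"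
  by (simp add: cesaro_def divide_ennreal_def inverse_ennreal inverse_eq_divide)

lemma cesaro_eq_nn_integral:
  assumes [measurable]: "g \<in> borel_measurable borel" and "0 < x"
  shows "cesaro g x = (\<integral>\<^sup>+t. g t * (ennreal (1 / x) * indicator {0..x} t) \<partial>lborel)"
proof -
  have "cesaro g x = (\<integral>\<^sup>+t. (g t * indicator {0..x} t) * ennreal (1 / x) \<partial>lborel)"
    unfolding cesaro_eq[OF \<open>0 < x\<close>] primitive_def by (rule nn_integral_multc[symmetric]) measurable
  then show ?thesis by (simp add: mult_ac)
qed

text \<open>
  Outside a set of measure \<open>s\<close> the point \<open>x\<close> lies in \<open>{s/2..1 - s/2}\<close>, where the kernel
  \<open>1/x\<close> on \<open>{0..x}\<close> is dominated by \<open>3 / (s + t)\<close> on \<open>{0..1 - s/2}\<close>.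
\<close>

lemma decr_rearr_cesaro_le:
  assumes [measurable]: "g \<in> borel_measurable borel" and s: "0 < s" "s \<le> 1"
  shows "decr_rearr (cesaro g) s
    \<le> (\<integral>\<^sup>+t. g t * (ennreal (3 / (s + t)) * indicator {0..1 - s / 2} t) \<partial>lborel)"
proof (rule decr_rearr_le)
  let ?X = "{0..s / 2} \<union> {1 - s / 2..1}"
  show "?X \<in> sets lebesgue" by simp
  have "emeasure lebesgue ?X \<le> emeasure lebesgue {0..s / 2} + emeasure lebesgue {1 - s / 2..1}"
    by (rule emeasure_subadditive) auto
  also have "\<dots> = ennreal s" using s by (simp flip: ennreal_plus)
  finally show "emeasure lebesgue ?X \<le> ennreal s" .
next
  fix x :: real assume x: "x \<in> {0..1}" "x \<notin> {0..s / 2} \<union> {1 - s / 2..1}"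
  then have x': "s / 2 < x" "x < 1 - s / 2" by auto
  then have "0 < x" using s by auto
  have "1 / x \<le> 3 / (s + t)" if "0 \<le> t" "t \<le> x" for t
    using that x' s by (simp add: field_simps)
  then show "cesaro g x
      \<le> (\<integral>\<^sup>+t. g t * (ennreal (3 / (s + t)) * indicator {0..1 - s / 2} t) \<partial>lborel)"
    unfolding cesaro_eq_nn_integral[OF assms(1) \<open>0 < x\<close>]
    using x' by (intro nn_integral_mono mult_left_mono) (auto simp: indicator_def intro!: ennreal_leI)
qed

lemma le_decr_rearr_cesaro_near_0:
  assumes [measurable]: "g \<in> borel_measurable borel" and s: "0 < s" "s \<le> 1 / 3"
  shows "primitive g s * ennreal (1 / (3 * s)) \<le> decr_rearr (cesaro g) s"
proof (rule le_decr_rearr)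
  show "{s..3 * s} \<subseteq> {0..1}" using s by auto
  show "ennreal s < emeasure lebesgue {s..3 * s}" using s by (simp add: ennreal_less_iff)
  show "primitive g s * ennreal (1 / (3 * s)) \<le> cesaro g x" if "x \<in> {s..3 * s}" for x
    using that s by (subst cesaro_eq) (auto intro!: mult_mono primitive_mono ennreal_leI simp: field_simps)
qed simp

lemma le_decr_rearr_cesaro_near_1:
  assumes [measurable]: "g \<in> borel_measurable borel" and s: "0 < s" "s \<le> 1 / 2"
  shows "primitive g (1 - 2 * s) \<le> decr_rearr (cesaro g) s"
\<comment> \<open>At \<open>s = 1 / 2\<close> the window reaches 0, where \<open>cesaro_eq\<close>
  does not apply; the left side is then \<open>primitive g 0 = 0\<close>.\<close>
proof (cases "s = 1 / 2")
  case False
  show ?thesis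
  proof (rule le_decr_rearr)
    show "{1 - 2 * s..1} \<subseteq> {0..1}" using s by auto
    show "ennreal s < emeasure lebesgue {1 - 2 * s..1}" using s by (simp add: ennreal_less_iff)
    show "primitive g (1 - 2 * s) \<le> cesaro g x" if x: "x \<in> {1 - 2 * s..1}" for x
    proof -
      have "0 < x" using x s False by auto
      moreover have "primitive g (1 - 2 * s) * 1 \<le> primitive g x * ennreal (1 / x)"
        using x \<open>0 < x\<close> by (intro mult_mono primitive_mono) (auto simp flip: ennreal_1 intro!: ennreal_leI)
      ultimately show ?thesis by (simp add: cesaro_eq)
    qed
  qed simp
next
  case True
  have "primitive g 0 = 0"
    unfolding primitive_def by (subst nn_integral_0_iff_AE)
      (use AE_lborel_singleton[of "0::real"] in \<open>auto elim!: eventually_mono simp: indicator_def\<close>)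
  moreover have "1 - 2 * s = 0" using True by simp
  ultimately show ?thesis by simp
qed

section \<open>Kernels integrated against the Stieltjes measure\<close>

context concave_weight begin

lemma Tonelli:
  assumes [measurable]: "g \<in> borel_measurable borel"
    "case_prod K \<in> borel_measurable (borel \<Otimes>\<^sub>M borel)"
  shows "(\<integral>\<^sup>+s. (\<integral>\<^sup>+t. g t * K t s \<partial>lborel) \<partial>\<nu>) = (\<integral>\<^sup>+t. g t * (\<integral>\<^sup>+s. K t s \<partial>\<nu>) \<partial>lborel)"
proof -
  interpret \<nu>: sigma_finite_measure \<nu> by (rule sigma_finite_\<nu>)
  interpret pair_sigma_finite lborel \<nu> ..
  have "(\<integral>\<^sup>+s. (\<integral>\<^sup>+t. g t * K t s \<partial>lborel) \<partial>\<nu>) = (\<integral>\<^sup>+t. (\<integral>\<^sup>+s. g t * K t s \<partial>\<nu>) \<partial>lborel)"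
    by (rule Fubini') measurable
  also have "\<dots> = (\<integral>\<^sup>+t. g t * (\<integral>\<^sup>+s. K t s \<partial>\<nu>) \<partial>lborel)"
    by (intro nn_integral_cong nn_integral_cmult) measurable
  finally show ?thesis .
qed

lemma nn_integral_\<nu>_const_Icc:
  "0 \<le> a \<Longrightarrow> a \<le> b \<Longrightarrow> b \<le> 1 \<Longrightarrow> (\<integral>\<^sup>+s. c * indicator {a..b} s \<partial>\<nu>) = c * ennreal (\<phi> b - \<phi> a)"
  by (subst nn_integral_cmult_indicator) (auto simp: emeasure_\<nu>_Icc clamped_eq)

lemma nn_integral_\<nu>_const_Ioc:
  "0 \<le> a \<Longrightarrow> a \<le> b \<Longrightarrow> b \<le> 1 \<Longrightarrow> (\<integral>\<^sup>+s. c * indicator {a<..b} s \<partial>\<nu>) = c * ennreal (\<phi> b - \<phi> a)"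
  by (subst nn_integral_cmult_indicator) (auto simp: emeasure_\<nu>_Ioc clamped_eq)

lemma W_measurable [measurable]: "W \<in> borel_measurable borel"
proof -
  interpret \<nu>: sigma_finite_measure \<nu> by (rule sigma_finite_\<nu>)
  have "(\<lambda>t. \<integral>\<^sup>+s. ennreal (1 / (t + s)) * (if 0 \<le> s \<and> s \<le> 1 - t then 1 else 0) \<partial>\<nu>) \<in> borel_measurable borel"
    by measurable
  also have "(\<lambda>t. \<integral>\<^sup>+s. ennreal (1 / (t + s)) * (if 0 \<le> s \<and> s \<le> 1 - t then 1 else 0) \<partial>\<nu>) = W"
    by (intro ext, unfold W_def, intro nn_integral_cong) (auto simp: indicator_def)
  finally show ?thesis .
qed

text \<open>The kernel \<open>1 / (t + s)\<close> is at least 1 for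
  \<open>s \<le> 1 - t\<close>.\<close>

lemma phi_le_W:
  assumes "0 < t" "t \<le> 1"
  shows "ennreal (\<phi> (1 - t)) \<le> W t"
proof -
  have "ennreal (\<phi> (1 - t)) = (\<integral>\<^sup>+s. 1 * indicator {0..1 - t} s \<partial>\<nu>)"
    using assms zero by (subst nn_integral_\<nu>_const_Icc) auto
  also have "\<dots> \<le> W t"
    unfolding W_def using assms
    by (intro nn_integral_mono) (auto simp: indicator_def ennreal_ge_1)
  finally show ?thesis .
qed

text \<open>Up to \<open>1 - t\<close> the kernel is 3 times that of \<open>W\<close>. Beyond it
  \<open>s + t > 1\<close>, so the kernel is at most 3, and by \<open>doubling\<close> the remaining
  mass is at most \<open>\<phi> (1 - t)\<close>, hence at most \<open>W t\<close>.\<close>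

lemma kernel_upper:
  assumes "0 < t" "t \<le> 1"
  shows "(\<integral>\<^sup>+s. ennreal (3 / (s + t)) * indicator {0..min 1 (2 * (1 - t))} s \<partial>\<nu>) \<le> 6 * W t"
proof -
  define b where "b = min 1 (2 * (1 - t))"
  have b: "1 - t \<le> b" "b \<le> 1" "b \<le> 2 * (1 - t)" using assms by (auto simp: b_def)
  have "(\<integral>\<^sup>+s. ennreal (3 / (s + t)) * indicator {0..b} s \<partial>\<nu>)
      \<le> (\<integral>\<^sup>+s. 3 * (ennreal (1 / (t + s)) * indicator {0..1 - t} s) + 3 * indicator {1 - t<..b} s \<partial>\<nu>)"
  proof (intro nn_integral_mono)
    fix s
    have "ennreal (3 / (s + t)) = 3 * ennreal (1 / (t + s))" if "0 \<le> s"
      using that assms by (simp flip: ennreal_numeral ennreal_mult add: add.commute)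
    moreover have "ennreal (3 / (s + t)) \<le> 3" if "1 - t < s"
      using that assms by (simp flip: ennreal_numeral add: field_simps)
    ultimately show "ennreal (3 / (s + t)) * indicator {0..b} s
       \<le> 3 * (ennreal (1 / (t + s)) * indicator {0..1 - t} s) + 3 * indicator {1 - t<..b} s"
      by (auto simp: indicator_def)
  qed
  also have "\<dots> = 3 * W t + 3 * ennreal (\<phi> b - \<phi> (1 - t))"
    using assms b
    by (subst nn_integral_add) (simp_all add: nn_integral_cmult W_def emeasure_\<nu>_Ioc clamped_eq)
  also have "\<dots> \<le> 3 * W t + 3 * W t"
  proof (intro add_left_mono mult_left_mono)
    have "\<phi> b \<le> 2 * \<phi> (1 - t)" using assms b by (intro doubling) auto
    then have "ennreal (\<phi> b - \<phi> (1 - t)) \<le> ennreal (\<phi> (1 - t))" by (intro ennreal_leI) auto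
    also have "\<dots> \<le> W t" using assms by (rule phi_le_W)
    finally show "ennreal (\<phi> b - \<phi> (1 - t)) \<le> W t" .
  qed auto
  also have "\<dots> = 6 * W t" by (simp flip: distrib_right)
  finally show ?thesis by (simp add: b_def)
qed

text \<open>The cut at \<open>1/3\<close> is the range of \<open>s\<close> in
  \<open>le_decr_rearr_cesaro_near_0\<close>, where the window \<open>{s..3 * s}\<close> fits into
  \<open>{0..1}\<close>.\<close>

definition V :: "real \<Rightarrow> ennreal" where
  "V t = (\<integral>\<^sup>+s. ennreal (1 / s) * indicator {t..1/3} s \<partial>\<nu>)"

text \<open>
  Near \<open>0\<close> the dangerous contribution to \<open>W t\<close> is \<open>\<phi> t / t\<close> from \<open>s \<le> t\<close>; since
  \<open>\<phi> (t / a) \<ge> 2 * \<phi> t\<close> it is absorbed by the part of \<open>V t\<close> over \<open>{t..t / a}\<close>.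
\<close>

lemma kernel_lower: "\<exists>K>0. \<forall>t. 0 < t \<longrightarrow> t \<le> 1 \<longrightarrow> W t \<le> ennreal K * (V t + ennreal (\<phi> (1 - t)))"
proof -
  obtain a where a: "0 < a" "a < 1" and half: "\<And>t. 0 < t \<Longrightarrow> t \<le> 1 \<Longrightarrow> \<phi> (a * t) \<le> 1 / 2 * \<phi> t"
    using small_dilation[of "1 / 2"] by auto
  have "W t \<le> ennreal (6 / a) * (V t + ennreal (\<phi> (1 - t)))" if t: "0 < t" "t \<le> 1" for t
  \<comment> \<open>The threshold makes \<open>t / a \<le> 1 / 3\<close>, so that
    \<open>{t..t / a}\<close> lies in the range of \<open>V\<close>. Above it
    \<open>1 / t < 3 / a\<close>, and \<open>\<phi> (1 - t)\<close> alone suffices.\<close>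
  proof (cases "t \<le> a / 3")
    case False
    have "W t \<le> (\<integral>\<^sup>+s. ennreal (1 / t) * indicator {0..1 - t} s \<partial>\<nu>)"
      unfolding W_def using t
      by (intro nn_integral_mono) (auto simp: indicator_def intro!: ennreal_leI divide_left_mono)
    also have "\<dots> = ennreal (1 / t) * ennreal (\<phi> (1 - t))"
      using t zero by (subst nn_integral_\<nu>_const_Icc) auto
    also have "\<dots> \<le> ennreal (6 / a) * (V t + ennreal (\<phi> (1 - t)))"
      using False a t by (intro mult_mono ennreal_leI) (auto simp: field_simps)
    finally show ?thesis .
  next
    case True
    define u where "u = t / a"
    have u: "t < u" "u \<le> 1 / 3" "a * u = t" "0 < u" using True a t by (auto simp: u_def field_simps)
    have t3: "t < 1 / 3" using u by simp
    \<comment> \<open>The kernel is bounded by \<open>1 / t\<close>, \<open>1 / s\<close> and 3 on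
      the pieces cut at \<open>t\<close> and \<open>1/3\<close>.\<close>
    have "W t \<le> (\<integral>\<^sup>+s. ennreal (1 / t) * indicator {0..t} s
        + ennreal (1 / s) * indicator {t..1/3} s + 3 * indicator {1/3<..1} s \<partial>\<nu>)"
      unfolding W_def
    proof (intro nn_integral_mono)
      fix s
      have "ennreal (1 / (t + s)) \<le> ennreal (1 / t)" if "0 \<le> s"
        using that t by (intro ennreal_leI) (auto simp: field_simps)
      moreover have "ennreal (1 / (t + s)) \<le> ennreal (1 / s)" if "t < s"
        using that t by (intro ennreal_leI) (auto simp: field_simps)
      moreover have "ennreal (1 / (t + s)) \<le> 3" if "1 / 3 < s"
        using that t by (simp flip: ennreal_numeral add: field_simps)
      moreover have "s \<le> t \<or> (t < s \<and> s \<le> 1 / 3) \<or> 1 / 3 < s" by auto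
      ultimately show "ennreal (1 / (t + s)) * indicator {0..1 - t} s
        \<le> ennreal (1 / t) * indicator {0..t} s + ennreal (1 / s) * indicator {t..1/3} s + 3 * indicator {1/3<..1} s"
        using t by (auto simp: indicator_def intro: order_trans[OF _ add_increasing] order_trans)
    qed
    also have "\<dots> = ennreal (1 / t) * ennreal (\<phi> t) + V t + 3 * ennreal (\<phi> 1 - \<phi> (1/3))"
      using t zero by (simp add: nn_integral_add V_def nn_integral_\<nu>_const_Ioc nn_integral_\<nu>_const_Icc)
    also have "\<dots> \<le> ennreal (1 / a) * V t + V t + 6 * ennreal (\<phi> (1 - t))"
    proof (intro add_mono order_refl)
      have "ennreal (1 / t) * ennreal (\<phi> t) \<le> ennreal (1 / a) * (ennreal (1 / u) * ennreal (\<phi> u - \<phi> t))"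
      proof -
        have "2 * \<phi> t \<le> \<phi> u" using half[of u] u by auto
        then have "1 / t * \<phi> t \<le> 1 / a * (1 / u * (\<phi> u - \<phi> t))"
          using t a by (simp add: u_def field_simps)
        then show ?thesis using t a u nonneg[of t] mono[of t u]
          by (simp flip: ennreal_mult add: ennreal_leI)
      qed
      also have "ennreal (1 / u) * ennreal (\<phi> u - \<phi> t) = (\<integral>\<^sup>+s. ennreal (1 / u) * indicator {t..u} s \<partial>\<nu>)"
        using t u by (subst nn_integral_\<nu>_const_Icc) auto
      also have "\<dots> \<le> V t"
        unfolding V_def using t u
        by (intro nn_integral_mono) (auto simp: indicator_def intro!: ennreal_leI divide_left_mono)
      finally show "ennreal (1 / t) * ennreal (\<phi> t) \<le> ennreal (1 / a) * V t"
        by (simp add: mult_left_mono)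
      \<comment> \<open>Here \<open>t < 1 / 3\<close> gives
        \<open>1 \<le> 2 * (1 - t)\<close>.\<close>
      have "\<phi> 1 \<le> 2 * \<phi> (1 - t)" using t t3 by (intro doubling) auto
      then have "3 * (\<phi> 1 - \<phi> (1/3)) \<le> 6 * \<phi> (1 - t)" using nonneg[of "1/3"] by auto
      then show "3 * ennreal (\<phi> 1 - \<phi> (1/3)) \<le> 6 * ennreal (\<phi> (1 - t))"
        using nonneg[of "1 - t"] mono[of "1/3" 1] t
        by (simp flip: ennreal_mult ennreal_numeral add: ennreal_leI)
    qed
    also have "\<dots> = ennreal (1 / a + 1) * V t + ennreal 6 * ennreal (\<phi> (1 - t))"
      using a by (simp add: distrib_right)
    also have "\<dots> \<le> ennreal (6 / a) * V t + ennreal (6 / a) * ennreal (\<phi> (1 - t))"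
      using a by (intro add_mono mult_right_mono ennreal_leI) (auto simp: field_simps)
    finally show ?thesis by (simp add: distrib_left)
  qed
  then show ?thesis using a by (intro exI[of _ "6 / a"]) auto
qed

section \<open>Norm comparison for Borel functions\<close>

text \<open>Integrate \<open>decr_rearr_cesaro_le\<close> over \<open>s\<close>, exchange the
  integrals, and apply \<open>kernel_upper\<close> for fixed \<open>t\<close>; the points
  \<open>s = 0\<close> and \<open>t = 0\<close> are null.\<close>

lemma lorentz_norm_cesaro_le:
  assumes [measurable]: "g \<in> borel_measurable borel"
  shows "lorentz_norm \<phi> (cesaro g) \<le> 6 * (\<integral>\<^sup>+t. g t * W t * indicator {0..1} t \<partial>lborel)"
proof -
  define K :: "real \<Rightarrow> real \<Rightarrow> ennreal" where
    "K t s = ennreal (3 / (s + t)) * (if 0 \<le> t \<and> t \<le> 1 - s / 2 \<and> 0 \<le> s \<and> s \<le> 1 then 1 else 0)" for t s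
  have [measurable]: "case_prod K \<in> borel_measurable (borel \<Otimes>\<^sub>M borel)"
    unfolding K_def by measurable
  have "lorentz_norm \<phi> (cesaro g) \<le> (\<integral>\<^sup>+s. (\<integral>\<^sup>+t. g t * K t s \<partial>lborel) \<partial>\<nu>)"
    unfolding lorentz_norm_def
  proof (rule nn_integral_mono_AE)
    show "AE s in \<nu>. decr_rearr (cesaro g) s * indicator {0..1} s \<le> (\<integral>\<^sup>+t. g t * K t s \<partial>lborel)"
      using AE_\<nu>_pos
    proof eventually_elim
      case (elim s)
      show ?case
      proof (cases "s \<le> 1")
        case True
        have "decr_rearr (cesaro g) s
            \<le> (\<integral>\<^sup>+t. g t * (ennreal (3 / (s + t)) * indicator {0..1 - s / 2} t) \<partial>lborel)"
          using decr_rearr_cesaro_le[OF assms elim True] .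
        also have "\<dots> = (\<integral>\<^sup>+t. g t * K t s \<partial>lborel)"
          using elim True by (intro nn_integral_cong) (auto simp: K_def indicator_def)
        finally show ?thesis using elim True by simp
      qed simp
    qed
  qed
  also have "\<dots> = (\<integral>\<^sup>+t. g t * (\<integral>\<^sup>+s. K t s \<partial>\<nu>) \<partial>lborel)"
    by (rule Tonelli) measurable
  also have "\<dots> \<le> (\<integral>\<^sup>+t. 6 * (g t * W t * indicator {0..1} t) \<partial>lborel)"
  proof (rule nn_integral_mono_AE)
    show "AE t in lborel. g t * (\<integral>\<^sup>+s. K t s \<partial>\<nu>) \<le> 6 * (g t * W t * indicator {0..1} t)"
      using AE_lborel_singleton[of 0]
    proof eventually_elim
      case (elim t)
      show ?case
      proof (cases "0 < t \<and> t \<le> 1")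
        case True
        have "(\<integral>\<^sup>+s. K t s \<partial>\<nu>) = (\<integral>\<^sup>+s. ennreal (3 / (s + t)) * indicator {0..min 1 (2 * (1 - t))} s \<partial>\<nu>)"
          using True by (intro nn_integral_cong) (auto simp: K_def indicator_def)
        also have "\<dots> \<le> 6 * W t" using True by (intro kernel_upper) auto
        finally have "g t * (\<integral>\<^sup>+s. K t s \<partial>\<nu>) \<le> g t * (6 * W t)" by (rule mult_left_mono) simp
        then show ?thesis using True by (simp add: mult_ac)
      next
        case False
        then have "K t s = 0" for s using elim by (auto simp: K_def)
        then show ?thesis by simp
      qed
    qed
  qed
  also have "\<dots> = 6 * (\<integral>\<^sup>+t. g t * W t * indicator {0..1} t \<partial>lborel)"
    by (rule nn_integral_cmult) measurable
  finally show ?thesis .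
qed

text \<open>For fixed \<open>t\<close> the kernel integrates to \<open>V t\<close>; for fixed
  \<open>s \<le> 1/3\<close> it yields the Cesaro mean at \<open>s\<close>, a third of which is
  below the rearrangement.\<close>

lemma V_le_lorentz_norm:
  assumes [measurable]: "g \<in> borel_measurable borel"
  shows "(\<integral>\<^sup>+t. g t * V t * indicator {0..1} t \<partial>lborel) \<le> 3 * lorentz_norm \<phi> (cesaro g)"
proof -
  define K :: "real \<Rightarrow> real \<Rightarrow> ennreal" where
    "K t s = ennreal (1 / s) * (if 0 \<le> t \<and> t \<le> s \<and> s \<le> 1 / 3 then 1 else 0)" for t s
  have [measurable]: "case_prod K \<in> borel_measurable (borel \<Otimes>\<^sub>M borel)"
    unfolding K_def by measurable
  interpret \<nu>: sigma_finite_measure \<nu> by (rule sigma_finite_\<nu>)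
  have "(\<integral>\<^sup>+t. g t * V t * indicator {0..1} t \<partial>lborel) \<le> (\<integral>\<^sup>+t. g t * (\<integral>\<^sup>+s. K t s \<partial>\<nu>) \<partial>lborel)"
  proof (intro nn_integral_mono)
    fix t
    have "V t = (\<integral>\<^sup>+s. K t s \<partial>\<nu>)" if "0 \<le> t"
      unfolding V_def using that by (intro nn_integral_cong) (auto simp: K_def indicator_def)
    then show "g t * V t * indicator {0..1} t \<le> g t * (\<integral>\<^sup>+s. K t s \<partial>\<nu>)"
      by (auto simp: indicator_def)
  qed
  also have "\<dots> = (\<integral>\<^sup>+s. (\<integral>\<^sup>+t. g t * K t s \<partial>lborel) \<partial>\<nu>)"
    by (rule Tonelli[symmetric]) measurable
  \<comment> \<open>The factor \<open>3 * (1 / 3)\<close> is inserted so that the integrand becomes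
    the lower bound near 0.\<close>
  also have "\<dots> = (\<integral>\<^sup>+s. 3 * ((\<integral>\<^sup>+t. g t * K t s \<partial>lborel) * ennreal (1 / 3)) \<partial>\<nu>)"
  proof (intro nn_integral_cong)
    have "ennreal 3 * ennreal (1 / 3) = 1" by (subst ennreal_mult[symmetric]) auto
    then have "x * (3 * ennreal (1 / 3)) = x" for x :: ennreal by simp
    then have "3 * (x * ennreal (1 / 3)) = x" for x :: ennreal by (subst mult.left_commute)
    then show "(\<integral>\<^sup>+t. g t * K t s \<partial>lborel) = 3 * ((\<integral>\<^sup>+t. g t * K t s \<partial>lborel) * ennreal (1 / 3))" for s
      by simp
  qed
  also have "\<dots> = 3 * (\<integral>\<^sup>+s. (\<integral>\<^sup>+t. g t * K t s \<partial>lborel) * ennreal (1 / 3) \<partial>\<nu>)"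
    by (rule nn_integral_cmult) measurable
  also have "\<dots> \<le> 3 * lorentz_norm \<phi> (cesaro g)"
    unfolding lorentz_norm_def
  proof (intro mult_left_mono nn_integral_mono_AE)
    show "AE s in \<nu>. (\<integral>\<^sup>+t. g t * K t s \<partial>lborel) * ennreal (1 / 3) \<le> decr_rearr (cesaro g) s * indicator {0..1} s"
      using AE_\<nu>_pos
    proof eventually_elim
      case (elim s)
      show ?case
      proof (cases "s \<le> 1 / 3")
        case True
        have "(\<integral>\<^sup>+t. g t * K t s \<partial>lborel) = cesaro g s"
          unfolding cesaro_eq_nn_integral[OF assms elim] using True
          by (intro nn_integral_cong) (auto simp: K_def indicator_def)
        also have "cesaro g s * ennreal (1 / 3) = primitive g s * ennreal (1 / (3 * s))"
          using elim by (simp add: cesaro_eq mult.assoc mult.commute[of 3] flip: ennreal_mult)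
        also have "\<dots> \<le> decr_rearr (cesaro g) s"
          using elim True by (intro le_decr_rearr_cesaro_near_0) auto
        finally show ?thesis using elim True by simp
      next
        case False
        then have "K t s = 0" for t by (auto simp: K_def)
        then show ?thesis by simp
      qed
    qed
  qed simp
  finally show ?thesis .
qed

text \<open>For fixed \<open>s\<close> the kernel gives \<open>primitive g (1 - 2 * s)\<close>. For
  fixed \<open>t\<close> it has mass \<open>\<phi> ((1 - t) / 2)\<close>, and
  \<open>doubling\<close> costs the factor 2.\<close>

lemma phi_le_lorentz_norm:
  assumes [measurable]: "g \<in> borel_measurable borel"
  shows "(\<integral>\<^sup>+t. g t * ennreal (\<phi> (1 - t)) * indicator {0..1} t \<partial>lborel) \<le> 2 * lorentz_norm \<phi> (cesaro g)"
proof -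
  define K :: "real \<Rightarrow> real \<Rightarrow> ennreal" where
    "K t s = (if 0 \<le> t \<and> t \<le> 1 - 2 * s \<and> 0 \<le> s then 1 else 0)" for t s
  have [measurable]: "case_prod K \<in> borel_measurable (borel \<Otimes>\<^sub>M borel)"
    unfolding K_def by measurable
  interpret \<nu>: sigma_finite_measure \<nu> by (rule sigma_finite_\<nu>)
  have "(\<integral>\<^sup>+t. g t * ennreal (\<phi> (1 - t)) * indicator {0..1} t \<partial>lborel)
      \<le> (\<integral>\<^sup>+t. 2 * (g t * (\<integral>\<^sup>+s. K t s \<partial>\<nu>)) \<partial>lborel)"
  proof (intro nn_integral_mono)
    fix t
    have "ennreal (\<phi> (1 - t)) \<le> 2 * (\<integral>\<^sup>+s. K t s \<partial>\<nu>)" if t: "0 \<le> t" "t \<le> 1"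
    proof -
      have "ennreal (\<phi> (1 - t)) \<le> ennreal (2 * \<phi> ((1 - t) / 2))"
        using t by (intro ennreal_leI doubling) auto
      also have "\<dots> = 2 * ennreal (\<phi> ((1 - t) / 2))"
        using t nonneg[of "(1 - t) / 2"] by (simp add: ennreal_mult)
      also have "ennreal (\<phi> ((1 - t) / 2)) = (\<integral>\<^sup>+s. 1 * indicator {0..(1 - t) / 2} s \<partial>\<nu>)"
        using t zero by (subst nn_integral_\<nu>_const_Icc) auto
      also have "\<dots> = (\<integral>\<^sup>+s. K t s \<partial>\<nu>)"
        using t by (intro nn_integral_cong) (auto simp: K_def indicator_def)
      finally show ?thesis .
    qed
    then have "g t * ennreal (\<phi> (1 - t)) \<le> g t * (2 * (\<integral>\<^sup>+s. K t s \<partial>\<nu>))" if "0 \<le> t" "t \<le> 1"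
      using that by (intro mult_left_mono) auto
    then show "g t * ennreal (\<phi> (1 - t)) * indicator {0..1} t \<le> 2 * (g t * (\<integral>\<^sup>+s. K t s \<partial>\<nu>))"
      by (auto simp: indicator_def mult.left_commute)
  qed
  also have "\<dots> = 2 * (\<integral>\<^sup>+t. g t * (\<integral>\<^sup>+s. K t s \<partial>\<nu>) \<partial>lborel)"
    by (rule nn_integral_cmult) measurable
  also have "(\<integral>\<^sup>+t. g t * (\<integral>\<^sup>+s. K t s \<partial>\<nu>) \<partial>lborel) = (\<integral>\<^sup>+s. (\<integral>\<^sup>+t. g t * K t s \<partial>lborel) \<partial>\<nu>)"
    by (rule Tonelli[symmetric]) measurable
  also have "\<dots> \<le> lorentz_norm \<phi> (cesaro g)"
    unfolding lorentz_norm_def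
  proof (rule nn_integral_mono_AE)
    show "AE s in \<nu>. (\<integral>\<^sup>+t. g t * K t s \<partial>lborel) \<le> decr_rearr (cesaro g) s * indicator {0..1} s"
      using AE_\<nu>_pos
    proof eventually_elim
      case (elim s)
      show ?case
      proof (cases "s \<le> 1 / 2")
        case True
        have "(\<integral>\<^sup>+t. g t * K t s \<partial>lborel) = primitive g (1 - 2 * s)"
          unfolding primitive_def using elim
          by (intro nn_integral_cong) (auto simp: K_def indicator_def)
        also have "\<dots> \<le> decr_rearr (cesaro g) s"
          using elim True by (intro le_decr_rearr_cesaro_near_1) auto
        finally show ?thesis using elim True by simp
      next
        case False
        then have "K t s = 0" for t by (auto simp: K_def)
        then show ?thesis by simp
      qed
    qed
  qed
  finally show ?thesis by (simp add: mult_left_mono)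
qed

lemma V_measurable [measurable]: "V \<in> borel_measurable borel"
proof -
  interpret \<nu>: sigma_finite_measure \<nu> by (rule sigma_finite_\<nu>)
  have "(\<lambda>t. \<integral>\<^sup>+s. ennreal (1 / s) * (if t \<le> s \<and> s \<le> 1/3 then 1 else 0) \<partial>\<nu>) \<in> borel_measurable borel"
    by measurable
  also have "(\<lambda>t. \<integral>\<^sup>+s. ennreal (1 / s) * (if t \<le> s \<and> s \<le> 1/3 then 1 else 0) \<partial>\<nu>) = V"
    by (intro ext, unfold V_def, intro nn_integral_cong) (auto simp: indicator_def)
  finally show ?thesis .
qed

lemma lorentz_norm_cesaro_ge:
  obtains c where "0 < c" "\<And>g. g \<in> borel_measurable borel \<Longrightarrow>
    ennreal c * (\<integral>\<^sup>+t. g t * W t * indicator {0..1} t \<partial>lborel) \<le> lorentz_norm \<phi> (cesaro g)"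
proof -
  obtain K where K: "0 < K"
    and W_le: "\<And>t. 0 < t \<Longrightarrow> t \<le> 1 \<Longrightarrow> W t \<le> ennreal K * (V t + ennreal (\<phi> (1 - t)))"
    using kernel_lower by auto
  show ?thesis
  \<comment> \<open>5 is the sum of the constants 3 and 2 in the bounds for \<open>V\<close> and for
    \<open>\<phi> (1 - t)\<close>.\<close>
  proof (rule that[of "1 / (5 * K)"])
    show "0 < 1 / (5 * K)" using K by simp
    fix g :: "real \<Rightarrow> ennreal" assume g [measurable]: "g \<in> borel_measurable borel"
    let ?L = "lorentz_norm \<phi> (cesaro g)"
    \<comment> \<open>Nothing is assumed about \<open>\<phi>\<close> outside \<open>{0..1}\<close>,
      so measurability on the line is obtained for \<open>clamped\<close>, which agrees with it
      where the indicator is nonzero.\<close>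
    have "(\<lambda>t. clamped (1 - t)) \<in> borel_measurable borel"
      using clamped_continuous
      by (intro borel_measurable_continuous_onI continuous_on_compose2[OF clamped_continuous])
        (auto intro!: continuous_intros)
    then have phi_meas: "(\<lambda>t. g t * ennreal (clamped (1 - t)) * indicator {0..1} t) \<in> borel_measurable lborel"
      by measurable
    have "(\<integral>\<^sup>+t. g t * W t * indicator {0..1} t \<partial>lborel)
      \<le> (\<integral>\<^sup>+t. ennreal K * (g t * V t * indicator {0..1} t + g t * ennreal (clamped (1 - t)) * indicator {0..1} t) \<partial>lborel)"
    proof (rule nn_integral_mono_AE)
      show "AE t in lborel. g t * W t * indicator {0..1} t
        \<le> ennreal K * (g t * V t * indicator {0..1} t + g t * ennreal (clamped (1 - t)) * indicator {0..1} t)"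
        using AE_lborel_singleton[of 0]
      proof eventually_elim
        case (elim t)
        show ?case
        proof (cases "t \<in> {0..1}")
          case True
          then have "g t * W t \<le> g t * (ennreal K * (V t + ennreal (\<phi> (1 - t))))"
            using elim by (intro mult_left_mono W_le) auto
          then show ?thesis using True by (simp add: clamped_eq distrib_left mult_ac)
        qed simp
      qed
    qed
    also have "\<dots> = ennreal K * ((\<integral>\<^sup>+t. g t * V t * indicator {0..1} t \<partial>lborel)
        + (\<integral>\<^sup>+t. g t * ennreal (clamped (1 - t)) * indicator {0..1} t \<partial>lborel))"
      using phi_meas by (simp add: nn_integral_cmult nn_integral_add)
    also have "(\<integral>\<^sup>+t. g t * ennreal (clamped (1 - t)) * indicator {0..1} t \<partial>lborel)
        = (\<integral>\<^sup>+t. g t * ennreal (\<phi> (1 - t)) * indicator {0..1} t \<partial>lborel)"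
      by (intro nn_integral_cong) (auto simp: indicator_def clamped_eq)
    also have "ennreal K * ((\<integral>\<^sup>+t. g t * V t * indicator {0..1} t \<partial>lborel) + \<dots>)
        \<le> ennreal K * (3 * ?L + 2 * ?L)"
      by (intro mult_left_mono add_mono V_le_lorentz_norm phi_le_lorentz_norm g) simp
    also have "\<dots> = ennreal (5 * K) * ?L"
      using K by (simp add: ennreal_mult mult_ac flip: distrib_right)
    finally have "ennreal (1 / (5 * K)) * (\<integral>\<^sup>+t. g t * W t * indicator {0..1} t \<partial>lborel)
        \<le> ennreal (1 / (5 * K)) * (ennreal (5 * K) * ?L)"
      by (intro mult_left_mono) auto
    also have "\<dots> = ?L"
      using K by (simp flip: mult.assoc ennreal_mult)
    finally show "ennreal (1 / (5 * K)) * (\<integral>\<^sup>+t. g t * W t * indicator {0..1} t \<partial>lborel) \<le> ?L" .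
  qed
qed

text \<open>Borel representatives make the Lebesgue measurable \<open>f\<close> accessible to Tonelli's theorem.\<close>

lemma borel_representative:
  assumes "f \<in> borel_measurable (lebesgue_on {0..1})"
  obtains g :: "real \<Rightarrow> ennreal" where "g \<in> borel_measurable borel"
    "lorentz_norm \<phi> (cesaro_abs f) = lorentz_norm \<phi> (cesaro g)"
    "L1w_norm (weight \<phi>) f = (\<integral>\<^sup>+t. g t * W t * indicator {0..1} t \<partial>lborel)"
proof -
  have "(\<lambda>t. ennreal \<bar>f t\<bar>) \<in> borel_measurable (lebesgue_on {0..1})"
    using assms by measurable
  then have "(\<lambda>t. ennreal \<bar>f t\<bar> * indicator {0..1} t) \<in> borel_measurable lebesgue"
    by (subst (asm) borel_measurable_restrict_space_iff_ennreal) auto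
  then obtain g where g: "g \<in> borel_measurable lborel"
    and eq: "AE t in lborel. ennreal \<bar>f t\<bar> * indicator {0..1} t = g t"
    using completion_ex_borel_measurable by blast
  \<comment> \<open>Only points of \<open>{0..1}\<close> count: \<open>g\<close> represents
    \<open>f\<close> cut off there, and \<open>decr_rearr\<close> ignores all others.\<close>
  have "cesaro_abs f x = cesaro g x" if "x \<in> {0..1}" for x
  proof -
    have "(\<integral>\<^sup>+t. ennreal \<bar>f t\<bar> * indicator {0..x} t \<partial>lborel) = primitive g x"
      unfolding primitive_def
    proof (rule nn_integral_cong_AE)
      show "AE t in lborel. ennreal \<bar>f t\<bar> * indicator {0..x} t = g t * indicator {0..x} t"
        using eq by eventually_elim (use that in \<open>auto simp: indicator_def\<close>)
    qed
    then show ?thesis by (simp add: cesaro_abs_def cesaro_def nn_integral_completion)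
  qed
  then have "lorentz_norm \<phi> (cesaro_abs f) = lorentz_norm \<phi> (cesaro g)"
    unfolding lorentz_norm_def by (subst decr_rearr_cong) auto
  moreover have "L1w_norm (weight \<phi>) f = (\<integral>\<^sup>+t. g t * W t * indicator {0..1} t \<partial>lborel)"
    unfolding L1w_norm_def nn_integral_completion
  proof (rule nn_integral_cong_AE)
    show "AE t in lborel. ennreal \<bar>f t\<bar> * weight \<phi> t * indicator {0..1} t = g t * W t * indicator {0..1} t"
      using eq AE_lborel_singleton[of 0]
      by eventually_elim (auto simp: indicator_def weight_eq_W)
  qed
  ultimately show ?thesis using that[of g] g by simp
qed

end

section \<open>From the lower index to small dilations\<close>

text \<open>By monotonicity the quotients are at most 1 for \<open>s \<le> 1\<close>, so the
  supremum is genuine and bounds each of them.\<close>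

lemma dil_fun_ge:
  assumes "mono_on {0..1} \<phi>" and pos: "\<And>t. 0 < t \<Longrightarrow> t \<le> 1 \<Longrightarrow> 0 < \<phi> t"
    and s: "0 < s" "s \<le> 1" and t: "0 < t" "t \<le> 1"
  shows "\<phi> (s * t) \<le> dil_fun \<phi> s * \<phi> t"
proof -
  have "min 1 (1 / s) = 1" using s by simp
  moreover have "bdd_above ((\<lambda>t. \<phi> (s * t) / \<phi> t) ` {0<..1})"
  proof (rule bdd_aboveI2)
    fix u :: real assume u: "u \<in> {0<..1}"
    then have su: "0 \<le> s * u" "s * u \<le> u" using s by (auto intro: mult_left_le_one_le)
    have "s * u \<in> {0..1}" "u \<in> {0..1}" using su u unfolding atLeastAtMost_iff greaterThanAtMost_iff by linarith+
    then have "\<phi> (s * u) \<le> \<phi> u" using su(2) by (rule mono_onD[OF assms(1)])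
    then show "\<phi> (s * u) / \<phi> u \<le> 1" using pos[of u] u by simp
  qed
  ultimately have "\<phi> (s * t) / \<phi> t \<le> dil_fun \<phi> s"
    unfolding dil_fun_def using t by (auto intro!: cSUP_upper)
  then show ?thesis using pos[OF t] by (simp add: field_simps)
qed

text \<open>Near 0 the quotient exceeds \<open>p / 2\<close> while \<open>ln s < 0\<close>, so
  \<open>ln (dil_fun \<phi> s) < p / 2 * ln s\<close>, which tends to minus infinity.\<close>

lemma small_dilation_of_index:
  assumes mono: "mono_on {0..1} \<phi>" and pos: "\<And>t. 0 < t \<Longrightarrow> t \<le> 1 \<Longrightarrow> 0 < \<phi> t"
    and lim: "((\<lambda>s. ln (dil_fun \<phi> s) / ln s) \<longlongrightarrow> p) (at_right 0)" and "0 < p" and "0 < e"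
  shows "\<exists>s\<in>{0<..<1}. \<forall>t\<in>{0<..1}. \<phi> (s * t) \<le> e * \<phi> t"
proof -
  have "\<forall>\<^sub>F s in at_right 0. p / 2 < ln (dil_fun \<phi> s) / ln s"
    using order_tendstoD(1)[OF lim, of "p / 2"] \<open>0 < p\<close> by simp
  moreover have "\<forall>\<^sub>F s in at_right 0. s \<in> {0<..<(1::real)}"
    by (rule eventually_at_rightI[of 0 1]) auto
  \<comment> \<open>The threshold is the one that turns \<open>p / 2 * ln s\<close> into something
    below \<open>ln e\<close>.\<close>
  moreover have "\<forall>\<^sub>F s in at_right 0. ln s < 2 / p * ln e"
    using ln_at_0 by (simp add: filterlim_at_bot_dense)
  ultimately have "\<forall>\<^sub>F s in at_right 0. p / 2 < ln (dil_fun \<phi> s) / ln s \<and> s \<in> {0<..<1} \<and> ln s < 2 / p * ln e"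
    by eventually_elim auto
  then obtain s where s: "p / 2 < ln (dil_fun \<phi> s) / ln s" "s \<in> {0<..<1}" "ln s < 2 / p * ln e"
    using eventually_happens'[OF trivial_limit_at_right_real] by blast
  \<comment> \<open>Logarithms can be compared back only for positive arguments; positivity follows
    from \<open>\<phi> s \<le> dil_fun \<phi> s * \<phi> 1\<close>.\<close>
  have "0 < \<phi> s" "0 < \<phi> 1" using pos s(2) by auto
  then have d: "0 < dil_fun \<phi> s"
    using dil_fun_ge[OF mono pos, of s 1] s(2) by (auto simp: zero_less_mult_iff dest: less_le_trans)
  have "ln (dil_fun \<phi> s) < p / 2 * ln s"
    using s(1,2) by (simp add: neg_less_divide_eq)
  also have "\<dots> < ln e" using s(3) \<open>0 < p\<close> by (simp add: field_simps)
  finally have "dil_fun \<phi> s < e" using d \<open>0 < e\<close> by simp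
  have "\<phi> (s * t) \<le> e * \<phi> t" if "t \<in> {0<..1}" for t
  proof -
    have "\<phi> (s * t) \<le> dil_fun \<phi> s * \<phi> t" using dil_fun_ge[OF mono pos] s(2) that by auto
    also have "\<dots> \<le> e * \<phi> t"
      using \<open>dil_fun \<phi> s < e\<close> pos[of t] that by (intro mult_right_mono) auto
    finally show ?thesis .
  qed
  then show ?thesis using s(2) by blast
qed

theorem theorem10:
  fixes \<phi> :: "real \<Rightarrow> real" and p q :: real
  assumes incr: "mono_on {0..1} \<phi>"
    and conc: "concave_on {0..1} \<phi>"
    and zero: "\<phi> 0 = 0"
    and pos: "\<And>t. 0 < t \<Longrightarrow> t \<le> 1 \<Longrightarrow> 0 < \<phi> t"
    and p_lim: "((\<lambda>s. ln (dil_fun \<phi> s) / ln s) \<longlongrightarrow> p) (at_right 0)"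
    and q_lim: "((\<lambda>s. ln (dil_fun \<phi> s) / ln s) \<longlongrightarrow> q) at_top"
    and "0 < p" and "p \<le> q" and "q < 1"
  shows "\<exists>c1 c2. 0 < c1 \<and> 0 < c2 \<and>
           (\<forall>f \<in> borel_measurable (lebesgue_on {0..1}).
              ennreal c1 * L1w_norm (weight \<phi>) f \<le> lorentz_norm \<phi> (cesaro_abs f) \<and>
              lorentz_norm \<phi> (cesaro_abs f) \<le> ennreal c2 * L1w_norm (weight \<phi>) f)"
proof -
  interpret concave_weight \<phi>
    by unfold_locales (use incr conc zero pos small_dilation_of_index[OF incr pos p_lim \<open>0 < p\<close>] in auto)
  obtain c where c: "0 < c" and lower: "\<And>g. g \<in> borel_measurable borel \<Longrightarrow>
      ennreal c * (\<integral>\<^sup>+t. g t * W t * indicator {0..1} t \<partial>lborel) \<le> lorentz_norm \<phi> (cesaro g)"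
    using lorentz_norm_cesaro_ge by blast
  \<comment> \<open>Both norms take values in \<open>ennreal\<close>, so the two inequalities also
    show that one is finite exactly when the other is: the spaces coincide as sets.\<close>
  have "ennreal c * L1w_norm (weight \<phi>) f \<le> lorentz_norm \<phi> (cesaro_abs f) \<and>
      lorentz_norm \<phi> (cesaro_abs f) \<le> ennreal 6 * L1w_norm (weight \<phi>) f"
    if f: "f \<in> borel_measurable (lebesgue_on {0..1})" for f
    by (rule borel_representative[OF f]) (use lower lorentz_norm_cesaro_le in simp)
  then show ?thesis using c by (intro exI[of _ c] exI[of _ 6]) auto
qed

end
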